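(* Let $G$ be a finite group. Then $rc(\Gamma_G^e)=2$ if and only if $G$ has an awning and $G$ is not a cyclic group.
   Context: Let $G$ be a finite group with identity $e$. The enhanced power graph $\Gamma_G^e$ has vertex set $G$, two distinct vertices $x,y$ being adjacent iff $x,y\in\langle z\rangle$ for some $z\in G$. For a connected graph $\Gamma$, an edge-colouring $\zeta:E(\Gamma)\to\{1,\dots,k\}$ (not necessarily proper) is a rainbow $k$-colouring if every pair of distinct vertices is joined by a path whose edges have pairwise distinct colours; $rc(\Gamma)$ is the minimum such $k$. An essential cyclic set $Max_G=\{x_1,\dots,x_m\}$ is a set of elements of $G$ such that $\langle x_1\rangle,\dots,\langle x_m\rangle$ are pairwise distinct and are exactly the maximal cyclic subgroups of $G$. Awning: given an ordering $x_1,\dots,x_m$ of $Max_G$, an awning is a family of indexed sets $H_1,\dots,H_{m-1}$, where $H_i=\{h_{i,i+1},\dots,h_{i,m}\}\subseteq\langle x_i\rangle$ is partitioned as $H_i=A_i\,\dot\cup\,B_i$, such that (1) $h_{i,j}\in\langle x_i\rangle\cap\langle x_j\rangle$ for all $i<j$; (2) whenever $i<j$, $2\le j\le m-1$, $s\in\{j+1,\dots,m\}$, $r\in\{i+1,\dots,m\}$ and $h_{j,s}=h_{i,r}$: (a) if $r=j$ and $h_{i,r}\in A_i$ then $h_{j,s}\in B_j$; (b) if $r=j$ and $h_{i,r}\in B_i$ then $h_{j,s}\in A_j$; (c) if $r=s>j$ and $h_{i,r}\in A_i$ then $h_{j,r}\in A_j$; (d) if $r=s>j$ and $h_{i,r}\in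 B_i$ then $h_{j,r}\in B_j$. $G$ has an awning if an awning exists for some ordering of $Max_G$. *)

theory Defs
  imports "HOL-Algebra.Elementary_Groups"
begin

text \<open>
  A simple graph is given by its vertex set and its set of edges, an edge being the two-element
  set of its endpoints.
\<close>

definition is_path :: "'v set \<Rightarrow> 'v set set \<Rightarrow> 'v \<Rightarrow> 'v list \<Rightarrow> 'v \<Rightarrow> bool" where
  "is_path V E u p v \<longleftrightarrow>
     p \<noteq> [] \<and> hd p = u \<and> last p = v \<and> distinct p \<and> set p \<subseteq> V \<and>
     successively (\<lambda>a b. {a, b} \<in> E) p"

fun path_edges :: "'v list \<Rightarrow> 'v set list" where
  "path_edges (a # b # p) = {a, b} # path_edges (b # p)"
| "path_edges _ = []"

definition rainbow_colouring :: "'v set \<Rightarrow> 'v set set \<Rightarrow> nat \<Rightarrow> ('v set \<Rightarrow> nat) \<Rightarrow> bool" where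
  "rainbow_colouring V E k \<zeta> \<longleftrightarrow>
     \<zeta> ` E \<subseteq> {1..k} \<and>
     (\<forall>u\<in>V. \<forall>v\<in>V. u \<noteq> v \<longrightarrow>
        (\<exists>p. is_path V E u p v \<and> distinct (map \<zeta> (path_edges p))))"

text \<open>Meaningful for finite connected graphs, where a rainbow colouring exists.\<close>

definition rainbow_connection_number :: "'v set \<Rightarrow> 'v set set \<Rightarrow> nat" where
  "rainbow_connection_number V E = (LEAST k. \<exists>\<zeta>. rainbow_colouring V E k \<zeta>)"

text \<open>The vertex set of the enhanced power graph is the carrier of the group.\<close>

definition enhanced_power_edges :: "('a, 'b) monoid_scheme \<Rightarrow> 'a set set" where
  "enhanced_power_edges G =
     {{x, y} | x y. x \<in> carrier G \<and> y \<in> carrier G \<and> x \<noteq> y \<and>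
        (\<exists>z\<in>carrier G. x \<in> generate G {z} \<and> y \<in> generate G {z})}"

definition cyclic_subgroups :: "('a, 'b) monoid_scheme \<Rightarrow> 'a set set" where
  "cyclic_subgroups G = {generate G {z} | z. z \<in> carrier G}"

definition maximal_cyclic_subgroups :: "('a, 'b) monoid_scheme \<Rightarrow> 'a set set" where
  "maximal_cyclic_subgroups G =
     {M \<in> cyclic_subgroups G. \<forall>C\<in>cyclic_subgroups G. M \<subseteq> C \<longrightarrow> C = M}"

definition essential_cyclic_set :: "('a, 'b) monoid_scheme \<Rightarrow> 'a set \<Rightarrow> bool" where
  "essential_cyclic_set G X \<longleftrightarrow>
     X \<subseteq> carrier G \<and>
     bij_betw (\<lambda>x. generate G {x}) X (maximal_cyclic_subgroups G)"

text \<open>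
  The ordering is \<open>x 1, \<dots>, x m\<close>; the entry \<open>h i j\<close> is relevant for \<open>1 \<le> i < j \<le> m\<close> only.
  The sets \<open>A i\<close> and \<open>B i\<close> partition the set of values of the \<open>i\<close>-th row of \<open>h\<close>, so that equal
  entries of a row lie in the same part; either part may be empty.
\<close>

definition awning ::
  "('a, 'b) monoid_scheme \<Rightarrow> nat \<Rightarrow> (nat \<Rightarrow> 'a) \<Rightarrow> (nat \<Rightarrow> nat \<Rightarrow> 'a) \<Rightarrow>
   (nat \<Rightarrow> 'a set) \<Rightarrow> (nat \<Rightarrow> 'a set) \<Rightarrow> bool" where
  "awning G m x h A B \<longleftrightarrow>
     (\<forall>i\<in>{1..m - 1}. h i ` {i + 1..m} \<subseteq> generate G {x i} \<and>
        h i ` {i + 1..m} = A i \<union> B i \<and> A i \<inter> B i = {}) \<and>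
     (\<forall>i\<in>{1..m}. \<forall>j\<in>{1..m}. i < j \<longrightarrow>
        h i j \<in> generate G {x i} \<inter> generate G {x j}) \<and>
     (\<forall>i\<in>{1..m - 1}. \<forall>j\<in>{2..m - 1}. \<forall>s\<in>{j + 1..m}. \<forall>r\<in>{i + 1..m}.
        i < j \<and> h j s = h i r \<longrightarrow>
          (r = j \<and> h i r \<in> A i \<longrightarrow> h j s \<in> B j) \<and>
          (r = j \<and> h i r \<in> B i \<longrightarrow> h j s \<in> A j) \<and>
          (r = s \<and> s > j \<and> h i r \<in> A i \<longrightarrow> h j r \<in> A j) \<and>
          (r = s \<and> s > j \<and> h i r \<in> B i \<longrightarrow> h j r \<in> B j))"

text \<open>
  The choice of the essential cyclic set does not matter, because the conditions on an awning
  involve \<open>x i\<close> only through the subgroup it generates.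
\<close>

definition has_awning :: "('a, 'b) monoid_scheme \<Rightarrow> bool" where
  "has_awning G \<longleftrightarrow>
     (\<exists>X x h A B. essential_cyclic_set G X \<and> bij_betw x {1..card X} X \<and>
        awning G (card X) x h A B)"

end

theory Submission
  imports Defs
begin

section \<open>Rainbow paths with few colours\<close>

lemma length_path_edges: "length (path_edges p) = length p - 1"
  by (induction p rule: path_edges.induct) auto

lemma set_path_edges:
  assumes "successively (\<lambda>a b. {a, b} \<in> E) p"
  shows "set (path_edges p) \<subseteq> E"
  using assms by (induction p rule: path_edges.induct) auto

text \<open>Pigeonhole on the colours; a path with \<open>n\<close> vertices has
  \<open>n - 1\<close> edges, hence the bound \<open>k + 1\<close>.\<close>

lemma rainbow_path_length_le:
  assumes "\<zeta> ` E \<subseteq> {1..k}" "is_path V E u p v" "distinct (map \<zeta> (path_edges p))"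
  shows "length p \<le> k + 1"
proof -
  have "set (map \<zeta> (path_edges p)) \<subseteq> {1..k}"
    using assms(1,2) set_path_edges[of E p] by (auto simp: is_path_def)
  then have "card (set (map \<zeta> (path_edges p))) \<le> k"
    using card_mono[of "{1..k}"] by fastforce
  then show ?thesis
    using distinct_card[OF assms(3)] by (simp add: length_path_edges)
qed

lemma rainbow_colouring_le_1_imp_edge:
  assumes "rainbow_colouring V E k \<zeta>" "k \<le> 1" "u \<in> V" "v \<in> V" "u \<noteq> v"
  shows "{u, v} \<in> E"
proof -
  obtain p where p: "is_path V E u p v" "distinct (map \<zeta> (path_edges p))"
    using assms unfolding rainbow_colouring_def by metis
  have "length p \<le> 2"
    using rainbow_path_length_le[OF _ p, of k] assms by (auto simp: rainbow_colouring_def)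
  then obtain a b where "p = [] \<or> p = [a] \<or> p = [a, b]"
    by (cases p; cases "tl p") auto
  then show ?thesis
    using p \<open>u \<noteq> v\<close> by (auto simp: is_path_def)
qed

text \<open>With two colours a rainbow path has at most three vertices, and non-adjacent ends leave
  exactly one inner vertex. This \<open>c\<close> later supplies the entries \<open>h i j\<close> of
  an awning.\<close>

lemma rainbow_2_colouring_obtains_middle:
  assumes "rainbow_colouring V E 2 \<zeta>" "u \<in> V" "v \<in> V" "u \<noteq> v" "{u, v} \<notin> E"
  obtains c where "{u, c} \<in> E" "{v, c} \<in> E" "\<zeta> {u, c} \<noteq> \<zeta> {v, c}"
proof -
  obtain p where p: "is_path V E u p v" "distinct (map \<zeta> (path_edges p))"
    using assms unfolding rainbow_colouring_def by metis
  have "length p \<le> 3"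
    using rainbow_path_length_le[OF _ p, of 2] assms by (auto simp: rainbow_colouring_def)
  then obtain a b c where "p = [] \<or> p = [a] \<or> p = [a, b] \<or> p = [a, c, b]"
    by (cases p; cases "tl p"; cases "tl (tl p)") auto
  then have "{u, c} \<in> E \<and> {v, c} \<in> E \<and> \<zeta> {u, c} \<noteq> \<zeta> {v, c}"
    using p assms(4,5) by (auto simp: is_path_def insert_commute)
  then show ?thesis
    using that by blast
qed

section \<open>Signs that separate the sets of a cover, and how they arise from an awning\<close>

text \<open>
  Every vertex \<open>u\<close> is represented by the least index \<open>f u\<close> of a set containing it, and the
  sign of \<open>c\<close> is renormalised by \<open>S (f c) c\<close>. If \<open>u\<close> and \<open>c\<close> each lie in the set
  representing the other, minimality gives \<open>f u = f c\<close>, and then both prescriptions for the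
  colour of \<open>{u, c}\<close> are the normalised sign \<open>False\<close>: no edge receives conflicting colours.
\<close>

lemma separating_signs_imp_rainbow_2_colouring:
  fixes M :: "nat \<Rightarrow> 'v set" and S :: "nat \<Rightarrow> 'v \<Rightarrow> bool"
  assumes V: "V = (\<Union>i\<in>I. M i)"
    and E: "\<And>u v. {u, v} \<in> E \<longleftrightarrow> u \<noteq> v \<and> (\<exists>i\<in>I. u \<in> M i \<and> v \<in> M i)"
    and sep: "\<And>i j. i \<in> I \<Longrightarrow> j \<in> I \<Longrightarrow> i < j \<Longrightarrow> \<exists>c\<in>M i \<inter> M j. S i c \<noteq> S j c"
  obtains \<zeta> where "rainbow_colouring V E 2 \<zeta>"
proof -
  define f where "f u = (LEAST i. i \<in> I \<and> u \<in> M i)" for u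
  have f: "f u \<in> I \<and> u \<in> M (f u)" if "u \<in> V" for u
    using that V LeastI_ex[of "\<lambda>i. i \<in> I \<and> u \<in> M i"] unfolding f_def by auto
  have f_le: "f u \<le> i" if "i \<in> I" "u \<in> M i" for u i
    using that Least_le[of "\<lambda>i. i \<in> I \<and> u \<in> M i" i] unfolding f_def by auto
  define \<zeta> :: "'v set \<Rightarrow> nat" where
    "\<zeta> e = (if \<exists>u c. e = {u, c} \<and> f c < f u \<and> S (f u) c \<noteq> S (f c) c then 2 else 1)" for e
  have \<zeta>: "\<zeta> {u, c} = (if S (f u) c \<noteq> S (f c) c then 2 else 1)" if "f c \<le> f u" for u c
  proof (cases "f c = f u")
    case True
    then show ?thesis
      by (auto simp: \<zeta>_def doubleton_eq_iff)
  next
    case False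
    then have "f c < f u"
      using that by simp
    \<comment> \<open>The strict inequality orients the edge, so the witnesses can only be
      \<open>u\<close> and \<open>c\<close> themselves.\<close>
    then have "(\<exists>u' c'. {u, c} = {u', c'} \<and> f c' < f u' \<and> S (f u') c' \<noteq> S (f c') c') \<longleftrightarrow>
        S (f u) c \<noteq> S (f c) c"
      by (metis doubleton_eq_iff less_asym)
    then show ?thesis
      by (simp only: \<zeta>_def)
  qed
  have "\<exists>p. is_path V E u p v \<and> distinct (map \<zeta> (path_edges p))"
    if uv: "u \<in> V" "v \<in> V" "u \<noteq> v" for u v
  proof (cases "{u, v} \<in> E")
    case True
    then have "is_path V E u [u, v] v \<and> distinct (map \<zeta> (path_edges [u, v]))"
      using uv by (simp add: is_path_def)
    then show ?thesis ..
  next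
    case False
    have ne: "v \<notin> M (f u)" "u \<notin> M (f v)"
      using False f uv by (auto simp: E)
    then have "f u \<noteq> f v"
      using f uv by metis
    then obtain c where c: "c \<in> M (f u)" "c \<in> M (f v)" "S (f u) c \<noteq> S (f v) c"
      using sep[of "f u" "f v"] sep[of "f v" "f u"] f uv by (metis IntE linorder_neqE_nat)
    \<comment> \<open>As \<open>c\<close> lies in both sets, minimality of \<open>f c\<close>
      applies at both ends. Both edges then compare their sign with the same
      \<open>S (f c) c\<close>, so the normalisation cancels and the differing signs become
      differing colours.\<close>
    then have "f c \<le> f u" "f c \<le> f v"
      using f f_le uv by auto
    then have "\<zeta> {u, c} \<noteq> \<zeta> {c, v}"
      using c \<zeta>[of c u] \<zeta>[of c v] by (auto simp: insert_commute)
    moreover have "{u, c} \<in> E" "{c, v} \<in> E" "c \<in> V" "c \<noteq> u" "c \<noteq> v"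
      using c f uv ne by (auto simp: E V)
    ultimately have "is_path V E u [u, c, v] v \<and> distinct (map \<zeta> (path_edges [u, c, v]))"
      using uv by (auto simp: is_path_def)
    then show ?thesis ..
  qed
  moreover have "\<zeta> ` E \<subseteq> {1..2}"
    by (auto simp: \<zeta>_def)
  ultimately have "rainbow_colouring V E 2 \<zeta>"
    by (simp add: rainbow_colouring_def)
  then show thesis ..
qed

text \<open>An entry \<open>c = h i j\<close> demands opposite signs of \<open>c\<close> at
  \<open>i\<close> and \<open>j\<close>: \<open>True\<close> at \<open>i\<close> and
  \<open>False\<close> at \<open>j\<close> if \<open>c\<close> is in \<open>A i\<close>, the reverse
  if it is in \<open>B i\<close>. The partition of the rows and the conditions on equal entries
  ensure that all demands on the same index and element agree.\<close>

lemma awning_separating_signs: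
  fixes G :: "('a, 'b) monoid_scheme"
  assumes aw: "awning G m x h A B"
  shows "\<exists>S :: nat \<Rightarrow> 'a \<Rightarrow> bool. \<forall>i j. 1 \<le> i \<and> i < j \<and> j \<le> m \<longrightarrow> S i (h i j) \<noteq> S j (h i j)"
proof -
  \<comment> \<open>The first disjunct collects positive demands from row \<open>i\<close>, the
    second those from column \<open>i\<close>, where membership in \<open>B k\<close> is reversed.
    Without any demand the sign is \<open>False\<close>.\<close>
  define S where "S i c \<longleftrightarrow> (\<exists>s. i < s \<and> s \<le> m \<and> h i s = c \<and> c \<in> A i) \<or>
      (\<exists>k. 1 \<le> k \<and> k < i \<and> h k i = c \<and> c \<in> B k)" for i c
  have part: "h i ` {i + 1..m} = A i \<union> B i" "A i \<inter> B i = {}" if "1 \<le> i" "i < m" for i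
    using aw that unfolding awning_def by auto
  \<comment> \<open>Reconciles the demand of row \<open>j\<close> itself with the one that an
    earlier row makes on index \<open>j\<close>.\<close>
  have row: "(h i j \<in> A i \<longrightarrow> h i j \<in> B j) \<and> (h i j \<in> B i \<longrightarrow> h i j \<in> A j)"
    if "1 \<le> i" "i < j" "j < s" "s \<le> m" "h j s = h i j" for i j s
  proof -
    have "i \<in> {1..m-1}" "j \<in> {2..m-1}" "s \<in> {j+1..m}" "j \<in> {i+1..m}"
      using that by auto
    then show ?thesis
      using aw that(2,5) unfolding awning_def by metis
  qed
  \<comment> \<open>Reconciles the demands that two rows make on the same column
    \<open>r\<close>.\<close>
  have col: "(h i r \<in> A i \<longrightarrow> h i r \<in> A j) \<and> (h i r \<in> B i \<longrightarrow> h i r \<in> B j)"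
    if "1 \<le> i" "i < j" "j < r" "r \<le> m" "h j r = h i r" for i j r
  proof -
    have "i \<in> {1..m-1}" "j \<in> {2..m-1}" "r \<in> {j+1..m}" "r \<in> {i+1..m}"
      using that by auto
    then show ?thesis
      using aw that(2,3,5) unfolding awning_def by metis
  qed
  have "S i (h i j) \<noteq> S j (h i j)" if ij: "1 \<le> i" "i < j" "j \<le> m" for i j
  proof (cases "h i j \<in> A i")
    case True
    have notB: "h i j \<notin> B i"
      using True part[of i] ij by auto
    have "\<not> S j (h i j)"
    proof
      assume "S j (h i j)"
      then consider s where "j < s" "s \<le> m" "h j s = h i j" "h i j \<in> A j"
        | k where "1 \<le> k" "k < j" "h k j = h i j" "h i j \<in> B k"
        by (auto simp: S_def)
      then show False
      proof cases
        case 1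
        then show False
          using row[of i j s] part[of j] True ij by auto
      next
        case 2
        \<comment> \<open>Rows \<open>i\<close> and \<open>k\<close> both have the element in column
          \<open>j\<close>, one in \<open>A i\<close>, the other in \<open>B k\<close>. Since
          \<open>col\<close> carries the class from the smaller row to the larger, their order
          decides which partition is contradicted.\<close>
        consider "k < i" | "k = i" | "i < k"
          by linarith
        then show False
        proof cases
          case 1
          then show False
            using col[of k i j] 2 notB ij by auto
        next
          case 2
          then show False
            using \<open>h i j \<in> B k\<close> notB by simp
        next
          case 3
          then show False
            using col[of i k j] part[of k] 2 True ij by auto
        qed
      qed
    qed
    moreover have "S i (h i j)"
      using True ij by (auto simp: S_def)
    ultimately show ?thesis
      by simp
  next
    case False
    then have "h i j \<in> B i"
      using part[of i] ij by auto
    then have "S j (h i j)"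
      using ij by (auto simp: S_def)
    moreover have "\<not> S i (h i j)"
    proof
      assume "S i (h i j)"
      then obtain k where "1 \<le> k" "k < i" "h k i = h i j" "h i j \<in> B k"
        using False by (auto simp: S_def)
      then show False
        using row[of k i j] False ij by auto
    qed
    ultimately show ?thesis
      by simp
  qed
  then show ?thesis
    by (intro exI[of _ S]) simp
qed

section \<open>Maximal cyclic subgroups and adjacency in the enhanced power graph\<close>

lemma enhanced_power_edges_iff:
  "{u, v} \<in> enhanced_power_edges G \<longleftrightarrow> u \<in> carrier G \<and> v \<in> carrier G \<and> u \<noteq> v \<and>
     (\<exists>z\<in>carrier G. u \<in> generate G {z} \<and> v \<in> generate G {z})"
  unfolding enhanced_power_edges_def by (auto simp: doubleton_eq_iff)

context group
begin

lemma generate_singleton_subset: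
  assumes "z \<in> carrier G" "x \<in> generate G {z}"
  shows "generate G {x} \<subseteq> generate G {z}"
  using assms generate_subgroup_incl[of "{x}" "generate G {z}"] generate_is_subgroup[of "{z}"]
  by auto

lemma finite_cyclic_subgroups:
  assumes "finite (carrier G)"
  shows "finite (cyclic_subgroups G)"
proof -
  have "cyclic_subgroups G = (\<lambda>z. generate G {z}) ` carrier G"
    by (auto simp: cyclic_subgroups_def)
  then show ?thesis
    using assms by simp
qed

lemma subset_maximal_cyclic_subgroup:
  assumes "finite (carrier G)" "z \<in> carrier G"
  obtains M where "M \<in> maximal_cyclic_subgroups G" "generate G {z} \<subseteq> M"
proof -
  have "generate G {z} \<in> cyclic_subgroups G"
    using assms(2) by (auto simp: cyclic_subgroups_def)
  then obtain M where "M \<in> cyclic_subgroups G" "generate G {z} \<subseteq> M"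
      "\<forall>C\<in>cyclic_subgroups G. M \<subseteq> C \<longrightarrow> M = C"
    using finite_has_maximal2[OF finite_cyclic_subgroups[OF assms(1)]] by metis
  then show thesis
    using that[of M] by (auto simp: maximal_cyclic_subgroups_def)
qed

text \<open>The cyclic subgroup witnessing the edge contains \<open>generate G {x}\<close>, so by
  maximality it equals it.\<close>

lemma edge_in_maximal_cyclic_subgroup:
  assumes "generate G {x} \<in> maximal_cyclic_subgroups G" "{x, y} \<in> enhanced_power_edges G"
  shows "y \<in> generate G {x}"
proof -
  obtain z where z: "z \<in> carrier G" "x \<in> generate G {z}" "y \<in> generate G {z}"
    using assms(2) by (auto simp: enhanced_power_edges_iff)
  then have "generate G {z} = generate G {x}"
    using assms(1) generate_singleton_subset[of z x]
    by (auto simp: maximal_cyclic_subgroups_def cyclic_subgroups_def)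
  then show ?thesis
    using z by simp
qed

lemma cyclic_group_iff_generate: "cyclic_group G \<longleftrightarrow> (\<exists>z\<in>carrier G. carrier G = generate G {z})"
  unfolding cyclic_group by (auto simp: generate_pow full_SetCompr_eq)

text \<open>In a complete graph a generator of any maximal cyclic subgroup is adjacent to all other
  elements, so its subgroup is the whole group.\<close>

lemma cyclic_group_iff_complete:
  assumes "finite (carrier G)"
  shows "cyclic_group G \<longleftrightarrow>
    (\<forall>u\<in>carrier G. \<forall>v\<in>carrier G. u \<noteq> v \<longrightarrow> {u, v} \<in> enhanced_power_edges G)"
proof
  assume "cyclic_group G"
  then obtain z where "z \<in> carrier G" "carrier G = generate G {z}"
    using cyclic_group_iff_generate by blast
  then show "\<forall>u\<in>carrier G. \<forall>v\<in>carrier G. u \<noteq> v \<longrightarrow> {u, v} \<in> enhanced_power_edges G"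
    by (auto simp: enhanced_power_edges_iff)
next
  assume *: "\<forall>u\<in>carrier G. \<forall>v\<in>carrier G. u \<noteq> v \<longrightarrow> {u, v} \<in> enhanced_power_edges G"
  obtain M where "M \<in> maximal_cyclic_subgroups G"
    using subset_maximal_cyclic_subgroup[OF assms one_closed] .
  then obtain x where x: "x \<in> carrier G" "generate G {x} \<in> maximal_cyclic_subgroups G"
    by (auto simp: maximal_cyclic_subgroups_def cyclic_subgroups_def)
  have "y \<in> generate G {x}" if "y \<in> carrier G" for y
  proof (cases "y = x")
    case True
    then show ?thesis
      by (simp add: generate.incl)
  next
    case False
    then show ?thesis
      using * x that edge_in_maximal_cyclic_subgroup[OF x(2)] by simp
  qed
  then have "carrier G = generate G {x}"
    using x generate_incl[of "{x}"] by auto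
  then show "cyclic_group G"
    using x cyclic_group_iff_generate by blast
qed

lemma ex_essential_cyclic_set:
  obtains X where "essential_cyclic_set G X"
proof -
  define g where "g = (\<lambda>M. SOME x. x \<in> carrier G \<and> generate G {x} = M)"
  have g: "g M \<in> carrier G" "generate G {g M} = M" if "M \<in> maximal_cyclic_subgroups G" for M
    using that someI_ex[of "\<lambda>x. x \<in> carrier G \<and> generate G {x} = M"]
    unfolding g_def by (auto simp: maximal_cyclic_subgroups_def cyclic_subgroups_def)
  have "essential_cyclic_set G (g ` maximal_cyclic_subgroups G)"
    unfolding essential_cyclic_set_def bij_betw_def inj_on_def using g by (auto simp: image_image)
  then show thesis ..
qed

section \<open>When the rainbow connection number is two\<close>

text \<open>Guarantees that the \<open>LEAST\<close> in \<open>rainbow_connection_number\<close> is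
  attained. Giving each edge its own colour makes every path rainbow, and \<open>\<one>\<close> is
  adjacent to every other vertex.\<close>

lemma ex_rainbow_colouring:
  assumes "finite (carrier G)"
  obtains k \<zeta> where "rainbow_colouring (carrier G) (enhanced_power_edges G) k \<zeta>"
proof -
  let ?E = "enhanced_power_edges G"
  have "?E \<subseteq> Pow (carrier G)"
    by (auto simp: enhanced_power_edges_def)
  then have "finite ?E"
    using assms finite_subset by blast
  then obtain \<zeta> where \<zeta>: "bij_betw \<zeta> ?E {1..card ?E}"
    using ex_bij_betw_nat_finite_1 bij_betw_inv by blast
  have star: "{u, \<one>} \<in> ?E" if "u \<in> carrier G" "u \<noteq> \<one>" for u
    using that generate.one generate.incl by (fastforce simp: enhanced_power_edges_iff)
  have "\<exists>p. is_path (carrier G) ?E u p v \<and> distinct (map \<zeta> (path_edges p))"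
    if uv: "u \<in> carrier G" "v \<in> carrier G" "u \<noteq> v" for u v
  proof (cases "{u, v} \<in> ?E")
    case True
    then have "is_path (carrier G) ?E u [u, v] v \<and> distinct (map \<zeta> (path_edges [u, v]))"
      using uv by (simp add: is_path_def)
    then show ?thesis ..
  next
    case False
    then have ne: "u \<noteq> \<one>" "v \<noteq> \<one>"
      using star uv by (auto simp: insert_commute)
    then have e: "{u, \<one>} \<in> ?E" "{\<one>, v} \<in> ?E"
      using star[OF uv(1)] star[OF uv(2)] by (auto simp: insert_commute)
    moreover have "{u, \<one>} \<noteq> {\<one>, v}"
      using uv by (auto simp: doubleton_eq_iff)
    ultimately have "\<zeta> {u, \<one>} \<noteq> \<zeta> {\<one>, v}"
      using \<zeta> by (auto simp: bij_betw_def dest: inj_onD)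
    then have "is_path (carrier G) ?E u [u, \<one>, v] v \<and>
        distinct (map \<zeta> (path_edges [u, \<one>, v]))"
      using uv e ne by (auto simp: is_path_def)
    then show ?thesis ..
  qed
  then have "rainbow_colouring (carrier G) ?E (card ?E) \<zeta>"
    using \<zeta> by (simp add: rainbow_colouring_def bij_betw_def)
  then show thesis ..
qed

text \<open>At most one colour suffices precisely for a complete graph, that is, for a cyclic
  group.\<close>

lemma rainbow_connection_number_eq_2_iff:
  assumes "finite (carrier G)"
  shows "rainbow_connection_number (carrier G) (enhanced_power_edges G) = 2 \<longleftrightarrow>
    (\<exists>\<zeta>. rainbow_colouring (carrier G) (enhanced_power_edges G) 2 \<zeta>) \<and> \<not> cyclic_group G"
    (is "?rc = 2 \<longleftrightarrow> (\<exists>\<zeta>. ?R 2 \<zeta>) \<and> _")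
proof
  assume rc: "?rc = 2"
  have "\<exists>\<zeta>. ?R ?rc \<zeta>"
    unfolding rainbow_connection_number_def
    by (rule LeastI_ex) (use ex_rainbow_colouring[OF assms] in metis)
  moreover have "\<not> cyclic_group G"
  proof
    assume "cyclic_group G"
    then have edge: "{u, v} \<in> enhanced_power_edges G"
      if "u \<in> carrier G" "v \<in> carrier G" "u \<noteq> v" for u v
      using that cyclic_group_iff_complete[OF assms] by blast
    have "is_path (carrier G) (enhanced_power_edges G) u [u, v] v \<and>
        distinct (map (\<lambda>_. 1::nat) (path_edges [u, v]))"
      if "u \<in> carrier G" "v \<in> carrier G" "u \<noteq> v" for u v
      using that edge by (simp add: is_path_def)
    then have "?R 1 (\<lambda>_. 1)"
      unfolding rainbow_colouring_def by fastforce
    \<comment> \<open>Only an upper bound: for the trivial group the value is 0.\<close>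
    then have "?rc \<le> 1"
      unfolding rainbow_connection_number_def by (intro Least_le) blast
    then show False
      using rc by simp
  qed
  ultimately show "(\<exists>\<zeta>. ?R 2 \<zeta>) \<and> \<not> cyclic_group G"
    using rc by simp
next
  assume *: "(\<exists>\<zeta>. ?R 2 \<zeta>) \<and> \<not> cyclic_group G"
  show "?rc = 2"
    unfolding rainbow_connection_number_def
  proof (rule Least_equality)
    fix k
    assume "\<exists>\<zeta>. ?R k \<zeta>"
    then show "2 \<le> k"
      using * rainbow_colouring_le_1_imp_edge cyclic_group_iff_complete[OF assms]
      by (metis One_nat_def Suc_1 not_less_eq_eq)
  qed (use * in simp)
qed

section \<open>Awnings versus rainbow 2-colourings\<close>

text \<open>The maximal cyclic subgroups cover the group, every edge lies inside one of them, and
  the signs of the awning separate any two of them at \<open>h i j\<close>. So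
  \<open>separating_signs_imp_rainbow_2_colouring\<close> applies.\<close>

lemma has_awning_imp_rainbow_2_colouring:
  assumes fin: "finite (carrier G)" and "has_awning G"
  obtains \<zeta> where "rainbow_colouring (carrier G) (enhanced_power_edges G) 2 \<zeta>"
proof -
  obtain X x h A B where X: "essential_cyclic_set G X" "bij_betw x {1..card X} X"
    and aw: "awning G (card X) x h A B"
    using assms(2) by (auto simp: has_awning_def)
  let ?m = "card X"
  let ?M = "\<lambda>i. generate G {x i}"
  have max: "?M ` {1..?m} = maximal_cyclic_subgroups G"
    using bij_betw_trans[OF X(2)] X(1) by (auto simp: essential_cyclic_set_def bij_betw_def comp_def)
  have x: "x i \<in> carrier G" if "i \<in> {1..?m}" for i
    using X that by (auto simp: essential_cyclic_set_def bij_betw_def)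
  have cover: "\<exists>i\<in>{1..?m}. generate G {z} \<subseteq> ?M i" if "z \<in> carrier G" for z
    using subset_maximal_cyclic_subgroup[OF fin that] max by (metis (no_types, lifting) imageE)
  have M: "?M i \<subseteq> carrier G" if "i \<in> {1..?m}" for i
    using generate_incl[of "{x i}"] x[OF that] by simp
  obtain S :: "nat \<Rightarrow> 'a \<Rightarrow> bool"
    where S: "\<And>i j. 1 \<le> i \<Longrightarrow> i < j \<Longrightarrow> j \<le> ?m \<Longrightarrow> S i (h i j) \<noteq> S j (h i j)"
    using awning_separating_signs[OF aw] by metis
  show thesis
  proof (rule separating_signs_imp_rainbow_2_colouring)
    show "carrier G = (\<Union>i\<in>{1..?m}. ?M i)"
    proof
      show "carrier G \<subseteq> (\<Union>i\<in>{1..?m}. ?M i)"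
      proof
        fix z assume "z \<in> carrier G"
        then show "z \<in> (\<Union>i\<in>{1..?m}. ?M i)"
          using cover[of z] generate.incl[of z "{z}" G] by blast
      qed
    qed (use M in blast)
    show "{u, v} \<in> enhanced_power_edges G \<longleftrightarrow>
        u \<noteq> v \<and> (\<exists>i\<in>{1..?m}. u \<in> ?M i \<and> v \<in> ?M i)" for u v
    proof
      assume "{u, v} \<in> enhanced_power_edges G"
      then obtain z where "z \<in> carrier G" "u \<noteq> v" "u \<in> generate G {z}" "v \<in> generate G {z}"
        by (auto simp: enhanced_power_edges_iff)
      then show "u \<noteq> v \<and> (\<exists>i\<in>{1..?m}. u \<in> ?M i \<and> v \<in> ?M i)"
        using cover[of z] by blast
    next
      assume "u \<noteq> v \<and> (\<exists>i\<in>{1..?m}. u \<in> ?M i \<and> v \<in> ?M i)"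
      then obtain i where "u \<noteq> v" "i \<in> {1..?m}" "u \<in> ?M i" "v \<in> ?M i"
        by blast
      then show "{u, v} \<in> enhanced_power_edges G"
        using M[of i] x[of i] by (auto simp: enhanced_power_edges_iff)
    qed
    show "\<exists>c\<in>?M i \<inter> ?M j. S i c \<noteq> S j c" if "i \<in> {1..?m}" "j \<in> {1..?m}" "i < j" for i j
      using that S[of i j] aw unfolding awning_def by (intro bexI[of _ "h i j"]) auto
  qed (rule that)
qed

text \<open>Generators \<open>x i\<close> and \<open>x j\<close> of different maximal cyclic
  subgroups are non-adjacent, so a rainbow path joins them through a middle vertex, taken as
  \<open>h i j\<close>. The colour of its edge to \<open>x i\<close> sorts it into
  \<open>A i\<close> or \<open>B i\<close>.\<close>

lemma rainbow_2_colouring_imp_has_awning: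
  assumes fin: "finite (carrier G)"
    and R: "rainbow_colouring (carrier G) (enhanced_power_edges G) 2 \<zeta>"
  shows "has_awning G"
proof -
  let ?E = "enhanced_power_edges G"
  obtain X where X: "essential_cyclic_set G X"
    using ex_essential_cyclic_set .
  then have "finite X"
    using fin finite_subset by (auto simp: essential_cyclic_set_def)
  then obtain x where x: "bij_betw x {1..card X} X"
    using ex_bij_betw_nat_finite_1 by blast
  define m where "m = card X"
  have xc: "x i \<in> carrier G" "generate G {x i} \<in> maximal_cyclic_subgroups G" if "i \<in> {1..m}" for i
  proof -
    have "x i \<in> X"
      using x that by (auto simp: bij_betw_def m_def)
    then show "x i \<in> carrier G" "generate G {x i} \<in> maximal_cyclic_subgroups G"
      using X by (auto simp: essential_cyclic_set_def bij_betw_def)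
  qed
  have M_inj: "generate G {x i} \<noteq> generate G {x j}" if "i \<in> {1..m}" "j \<in> {1..m}" "i < j" for i j
  proof -
    have inj: "inj_on x {1..m}" "inj_on (\<lambda>x. generate G {x}) X"
      using X x by (simp_all add: essential_cyclic_set_def bij_betw_def m_def)
    have "x i \<in> X" "x j \<in> X"
      using x that by (auto simp: bij_betw_def m_def)
    then show ?thesis
      using inj_onD[OF inj(1), of i j] inj_onD[OF inj(2), of "x i" "x j"] that by auto
  qed
  have nonadj: "x i \<noteq> x j" "{x i, x j} \<notin> ?E" if ij: "i \<in> {1..m}" "j \<in> {1..m}" "i < j" for i j
  proof -
    show "x i \<noteq> x j"
      using M_inj[OF ij] by auto
    show "{x i, x j} \<notin> ?E"
    proof
      assume e: "{x i, x j} \<in> ?E"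
      \<comment> \<open>Each generator would lie in the subgroup of the other, making the two
        subgroups equal.\<close>
      then have "x j \<in> generate G {x i}" "x i \<in> generate G {x j}"
        using edge_in_maximal_cyclic_subgroup xc ij by (auto simp: insert_commute)
      then have "generate G {x i} = generate G {x j}"
        using generate_singleton_subset xc(1) ij by (meson subset_antisym)
      then show False
        using M_inj[OF ij] by simp
    qed
  qed
  define h where "h i j = (SOME c. {x i, c} \<in> ?E \<and> {x j, c} \<in> ?E \<and> \<zeta> {x i, c} \<noteq> \<zeta> {x j, c})"
    for i j
  have h: "{x i, h i j} \<in> ?E" "{x j, h i j} \<in> ?E" "\<zeta> {x i, h i j} \<noteq> \<zeta> {x j, h i j}"
    if ij: "i \<in> {1..m}" "j \<in> {1..m}" "i < j" for i j
  proof -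
    have "\<exists>c. {x i, c} \<in> ?E \<and> {x j, c} \<in> ?E \<and> \<zeta> {x i, c} \<noteq> \<zeta> {x j, c}"
      using rainbow_2_colouring_obtains_middle[OF R] xc ij nonadj[OF ij] by metis
    then have "{x i, h i j} \<in> ?E \<and> {x j, h i j} \<in> ?E \<and> \<zeta> {x i, h i j} \<noteq> \<zeta> {x j, h i j}"
      unfolding h_def by (rule someI_ex)
    then show "{x i, h i j} \<in> ?E" "{x j, h i j} \<in> ?E" "\<zeta> {x i, h i j} \<noteq> \<zeta> {x j, h i j}"
      by auto
  qed
  have two: "\<zeta> e = 1 \<or> \<zeta> e = 2" if "e \<in> ?E" for e
  proof -
    have "\<zeta> e \<in> {1..2}"
      using R that by (auto simp: rainbow_colouring_def)
    then show ?thesis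
      by auto
  qed
  have colours: "\<zeta> {x i, h i j} = 1 \<longleftrightarrow> \<zeta> {x j, h i j} \<noteq> 1"
    if "i \<in> {1..m}" "j \<in> {1..m}" "i < j" for i j
    using h[OF that] two by metis
  have hM: "h i j \<in> generate G {x i} \<inter> generate G {x j}"
    if "i \<in> {1..m}" "j \<in> {1..m}" "i < j" for i j
    using edge_in_maximal_cyclic_subgroup[OF xc(2) h(1)[OF that]]
      edge_in_maximal_cyclic_subgroup[OF xc(2) h(2)[OF that]] that by simp
  \<comment> \<open>Splitting each row by a condition and its negation makes the partition
    immediate; that only two colours occur enters through \<open>colours\<close>.\<close>
  define A where "A i = {c \<in> h i ` {i + 1..m}. \<zeta> {x i, c} = 1}" for i
  define B where "B i = {c \<in> h i ` {i + 1..m}. \<zeta> {x i, c} \<noteq> 1}" for i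
  have "awning G m x h A B"
    unfolding awning_def
  proof (intro conjI ballI impI)
    fix i assume i: "i \<in> {1..m - 1}"
    show "h i ` {i + 1..m} \<subseteq> generate G {x i}"
      using i hM[of i] by fastforce
    show "h i ` {i + 1..m} = A i \<union> B i" "A i \<inter> B i = {}"
      by (auto simp: A_def B_def)
  next
    fix i j assume "i \<in> {1..m}" "j \<in> {1..m}" "i < j"
    then show "h i j \<in> generate G {x i} \<inter> generate G {x j}"
      by (rule hM)
  next
    fix i j s r
    assume ran: "i \<in> {1..m - 1}" "j \<in> {2..m - 1}" "s \<in> {j + 1..m}" "r \<in> {i + 1..m}"
      and "i < j \<and> h j s = h i r"
    then have eq: "i < j" "h j s = h i r"
      by auto
    have mem: "i \<in> {1..m}" "j \<in> {1..m}" "s \<in> {1..m}" "r \<in> {1..m}" "j < s" "i < r"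
      using ran by auto
    have row: "h j s \<in> h j ` {j + 1..m}"
      using ran by blast
    {
      \<comment> \<open>The element is \<open>h i j\<close>, so \<open>colours\<close> swaps its
        class on passing from \<open>x i\<close> to \<open>x j\<close>.\<close>
      assume "r = j \<and> h i r \<in> A i"
      then show "h j s \<in> B j"
        using colours[of i j] mem eq row by (auto simp: A_def B_def)
    next
      assume "r = j \<and> h i r \<in> B i"
      then show "h j s \<in> A j"
        using colours[of i j] mem eq row by (auto simp: A_def B_def)
    next
      \<comment> \<open>The element is both \<open>h i s\<close> and \<open>h j s\<close>: its edges
        to \<open>x i\<close> and to \<open>x j\<close> each differ in colour from its edge to
        \<open>x s\<close>, so they agree.\<close>
      assume "r = s \<and> j < s \<and> h i r \<in> A i"
      then show "h j r \<in> A j"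
        using colours[of i s] colours[of j s] mem eq row by (auto simp: A_def)
    next
      assume "r = s \<and> j < s \<and> h i r \<in> B i"
      then show "h j r \<in> B j"
        using colours[of i s] colours[of j s] mem eq row by (auto simp: B_def)
    }
  qed
  then show ?thesis
    using X x unfolding has_awning_def m_def by blast
qed

end

theorem theorem2p17:
  fixes G :: "('a, 'b) monoid_scheme"
  assumes "group G" and "finite (carrier G)"
  shows "rainbow_connection_number (carrier G) (enhanced_power_edges G) = 2 \<longleftrightarrow>
    has_awning G \<and> \<not> cyclic_group G"
proof -
  interpret group G
    by (rule assms(1))
  show ?thesis
    using rainbow_connection_number_eq_2_iff[OF assms(2)]
      has_awning_imp_rainbow_2_colouring[OF assms(2)]
      rainbow_2_colouring_imp_has_awning[OF assms(2)] by metis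
qed

end
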